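(* Let $M\ge1$, $N\ge2$, $0\le i\le N-2$, and let $\epsilon\in\{0,1\}^N$ satisfy $\epsilon_i=0$ and $\epsilon_{i+1}=1$. Let $\epsilon'\in\{0,1\}^N$ be given by $\epsilon'_i=1$, $\epsilon'_{i+1}=0$ and $\epsilon'_j=\epsilon_j$ for $j\ne i,i+1$. Then the transformation $\varphi_i$ commutes with the time evolution of the discrete hungry elementary Toda orbits, i.e. as rational maps $$\varphi_i\circ \mathcal T_\epsilon=\mathcal T_{\epsilon'}\circ\varphi_i .$$
   Context: The phase space has coordinates $\big((q_l^{(0)},q_l^{(1)},\dots,q_l^{(M-1)})_{l=0}^{N-1},\ (e_l)_{l=0}^{N-2}\big)$, regarded as independent indeterminates. **Time evolution $\mathcal T_\epsilon$ (discrete hungry elementary Toda orbits).** For $\epsilon=(\epsilon_0,\dots,\epsilon_{N-1})\in\{0,1\}^N$, put $e_l^{(0)}:=e_l$ and, for $t=0,1,\dots,M-1$, define $q_l^{(t+M)}$ and $e_l^{(t+1)}$ recursively by $$q_l^{(t+M)}=q_l^{(t)}+e_l^{(t)}-e_{l-1}^{(t+1)},\quad 0\le l\le N-1,$$ $$e_l^{(t+1)}=\frac{q_{l+1}^{(t)}+\epsilon_{l+1}e_{l+1}^{(t)}}{q_l^{(t+M)}+\epsilon_l e_{l-1}^{(t+1)}}\,e_l^{(t)},\quad 0\le l\le N-2,$$ with $e_{-1}^{(t)}=0$ and $e_{N-1}^{(t)}=0$ for all $t$ (computed in the order $q_0^{(t+M)},e_0^{(t+1)},q_1^{(t+M)},e_1^{(t+1)},\dots$).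 Then $\mathcal T_\epsilon$ is the rational map $$\big((q_l^{(0)},\dots,q_l^{(M-1)})_{l},(e_l^{(0)})_l\big)\mapsto\big((q_l^{(M)},\dots,q_l^{(2M-1)})_{l},(e_l^{(M)})_l\big).$$ Equivalently, these equations are $L_1^{(t+1)}L_2^{(t+1)}R^{(t+M)}=R^{(t)}L_1^{(t)}L_2^{(t)}$, where (with $E_{a,b}$ the $N\times N$ matrix units, $I_N$ the identity) $R^{(t)}=\sum_{l=1}^N q_{l-1}^{(t)}E_{l,l}+\sum_{l=1}^{N-1}E_{l,l+1}$, $(L_1^{(t)})^{-1}=I_N-\sum_{l=1}^{N-1}\epsilon_{l-1}e_{l-1}^{(t)}E_{l+1,l}$, $L_2^{(t)}=I_N+\sum_{l=1}^{N-1}(1-\epsilon_{l-1})e_{l-1}^{(t)}E_{l+1,l}$. **Transformation $\varphi_i$.** It sends $\big((q_l^{(j)}),(e_l)\big)$ to $\big((\tilde q_l^{(j)}),(\tilde e_l)\big)$ as follows. Put $e_i^{(0,0)}:=e_i$ and for $j=1,2,\dots,M$ $$e_i^{(0,j)}=\frac{e_i^{(0,j-1)}q_i^{(M-j)}}{e_i^{(0,j-1)}+q_{i+1}^{(M-j)}},\quad \tilde q_i^{(M-j)}=\frac{q_{i+1}^{(M-j)}q_i^{(M-j)}}{e_i^{(0,j-1)}+q_{i+1}^{(M-j)}},\quad \tilde q_{i+1}^{(M-j)}=e_i^{(0,j-1)}+q_{i+1}^{(M-j)};$$ then $\tilde e_i:=e_i^{(0,M)}$, $\tilde q_l^{(j)}:=q_l^{(j)}$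 for $l\ne i,i+1$, and $\tilde e_l:=e_l$ for $l\ne i$. *)

theory Defs
  imports
    "HOL-Library.Poly_Mapping"
    "HOL-Library.Countable"
    "HOL-Computational_Algebra.Fraction_Field"
begin

section \<open>Rational functions in the phase space coordinates\<close>

text \<open>\<open>Q j l\<close> stands for $q_l^{(j)}$ (time first, site second) and \<open>E l\<close> for $e_l$.\<close>

datatype coord = Q nat nat | E nat

instance coord :: countable
  by countable_datatype

text \<open>An arbitrary linear order on the indeterminates; its only purpose is to make the
  library's \<open>idom\<close> instance for polynomials available.\<close>

instantiation coord :: linorder
begin

definition less_eq_coord :: "coord \<Rightarrow> coord \<Rightarrow> bool" where
  "less_eq_coord x y \<longleftrightarrow> to_nat x \<le> to_nat y"

definition less_coord :: "coord \<Rightarrow> coord \<Rightarrow> bool" where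
  "less_coord x y \<longleftrightarrow> to_nat x < to_nat y"

instance
  by standard (auto simp: less_eq_coord_def less_coord_def)

end

text \<open>Polynomials with coefficients in \<open>'k\<close>: finitely supported maps from monomials
  (exponent vectors) to coefficients.  There is one indeterminate for every element of
  \<^typ>\<open>coord\<close>; the phase space for given $M, N$ only involves the finitely many in
  \<open>phase_coords M N\<close> below.\<close>

type_synonym 'k cpoly = "(coord \<Rightarrow>\<^sub>0 nat) \<Rightarrow>\<^sub>0 'k"
type_synonym 'k ratfun = "'k cpoly fract"

definition Const :: "'k::field \<Rightarrow> 'k ratfun" where
  "Const a = Fract (Poly_Mapping.single 0 a) 1"

definition Var :: "coord \<Rightarrow> 'k::field ratfun" where
  "Var v = Fract (Poly_Mapping.single (Poly_Mapping.single v 1) 1) 1"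

definition phase_coords :: "nat \<Rightarrow> nat \<Rightarrow> coord set" where
  "phase_coords M N = {Q j l |j l. j < M \<and> l < N} \<union> {E l |l. l + 1 < N}"


section \<open>Rational maps and their composition\<close>

text \<open>A rational map is given by its components, one rational function for each coordinate.\<close>

type_synonym 'k ratmap = "coord \<Rightarrow> 'k ratfun"

definition monom_subst :: "'k::field ratmap \<Rightarrow> (coord \<Rightarrow>\<^sub>0 nat) \<Rightarrow> 'k ratfun" where
  "monom_subst G m = (\<Prod>v\<in>Poly_Mapping.keys m. G v ^ Poly_Mapping.lookup m v)"

definition poly_subst :: "'k::field ratmap \<Rightarrow> 'k cpoly \<Rightarrow> 'k ratfun" where
  "poly_subst G p =
     (\<Sum>m\<in>Poly_Mapping.keys p. Const (Poly_Mapping.lookup p m) * monom_subst G m)"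

text \<open>\<open>subst_rel G r s\<close>: the rational function \<open>r\<close> can be evaluated at \<open>G\<close>, with value \<open>s\<close>,
  i.e. \<open>r\<close> is a quotient of polynomials whose denominator does not vanish at \<open>G\<close>.
  The value is unique, see \<open>subst_rel_unique\<close> below.\<close>

definition subst_rel :: "'k::field ratmap \<Rightarrow> 'k ratfun \<Rightarrow> 'k ratfun \<Rightarrow> bool" where
  "subst_rel G r s \<longleftrightarrow>
     (\<exists>p d. poly_subst G d \<noteq> 0 \<and> r = Fract p d \<and> s = poly_subst G p / poly_subst G d)"

definition rat_composable :: "coord set \<Rightarrow> 'k::field ratmap \<Rightarrow> 'k ratmap \<Rightarrow> bool" where
  "rat_composable A F G \<longleftrightarrow> (\<forall>c\<in>A. \<exists>s. subst_rel G (F c) s)"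

definition rat_comp :: "'k::field ratmap \<Rightarrow> 'k ratmap \<Rightarrow> 'k ratmap" where
  "rat_comp F G c = (THE s. subst_rel G (F c) s)"


section \<open>The time evolution\<close>

text \<open>For a point with coordinates \<open>q j l\<close> ($= q_l^{(j)}$, $j < M$) and \<open>e l\<close>, and $t < M$:
  \<open>toda_q N \<epsilon> q e t l\<close> is $q_l^{(t+M)}$ and \<open>toda_e N \<epsilon> q e t l\<close> is $e_l^{(t)}$.
  Since $t < M$, the values $q_l^{(t)}$ on the right-hand sides are initial data, so that
  $M$ does not enter the recursion.\<close>

function toda_q :: "nat \<Rightarrow> (nat \<Rightarrow> nat) \<Rightarrow> (nat \<Rightarrow> nat \<Rightarrow> 'f) \<Rightarrow> (nat \<Rightarrow> 'f) \<Rightarrow> nat \<Rightarrow> nat \<Rightarrow> 'f::field"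
  and toda_e :: "nat \<Rightarrow> (nat \<Rightarrow> nat) \<Rightarrow> (nat \<Rightarrow> nat \<Rightarrow> 'f) \<Rightarrow> (nat \<Rightarrow> 'f) \<Rightarrow> nat \<Rightarrow> nat \<Rightarrow> 'f"
where
  "toda_q N \<epsilon> q e t l =
     q t l + toda_e N \<epsilon> q e t l - (if l = 0 then 0 else toda_e N \<epsilon> q e (Suc t) (l - 1))"
| "toda_e N \<epsilon> q e 0 l = (if l + 1 < N then e l else 0)"
| "toda_e N \<epsilon> q e (Suc t) l =
     (if l + 1 < N then
        (q t (l + 1) + of_nat (\<epsilon> (l + 1)) * toda_e N \<epsilon> q e t (l + 1)) /
        (toda_q N \<epsilon> q e t l
           + of_nat (\<epsilon> l) * (if l = 0 then 0 else toda_e N \<epsilon> q e (Suc t) (l - 1)))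
        * toda_e N \<epsilon> q e t l
      else 0)"
  by pat_completeness auto

termination
  by (relation "inv_image (less_than <*lex*> less_than <*lex*> less_than)
        (\<lambda>x. case x of Inl (N, \<epsilon>, q, e, t, l) \<Rightarrow> (Suc t, l, 0 :: nat)
                     | Inr (N, \<epsilon>, q, e, t, l) \<Rightarrow> (t, l, 1))") auto

declare toda_q.simps [simp del] toda_e.simps [simp del]

definition toda_map :: "nat \<Rightarrow> nat \<Rightarrow> (nat \<Rightarrow> nat) \<Rightarrow> 'k::field ratmap" where
  "toda_map M N \<epsilon> c =
     (if c \<in> phase_coords M N then
        (case c of
           Q j l \<Rightarrow> toda_q N \<epsilon> (\<lambda>j l. Var (Q j l)) (\<lambda>l. Var (E l)) j l
         | E l \<Rightarrow> toda_e N \<epsilon> (\<lambda>j l. Var (Q j l)) (\<lambda>l. Var (E l)) M l)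
      else Var c)"


section \<open>The transformation \<open>\<phi>\<^sub>i\<close>\<close>

text \<open>\<open>phi_e M i q e j\<close> is $e_i^{(0,j)}$.\<close>

primrec phi_e :: "nat \<Rightarrow> nat \<Rightarrow> (nat \<Rightarrow> nat \<Rightarrow> 'f) \<Rightarrow> (nat \<Rightarrow> 'f) \<Rightarrow> nat \<Rightarrow> 'f::field" where
  "phi_e M i q e 0 = e i"
| "phi_e M i q e (Suc j) =
     phi_e M i q e j * q (M - Suc j) i / (phi_e M i q e j + q (M - Suc j) (i + 1))"

text \<open>Superscripts are indexed by $m = M - j$, hence \<open>M - Suc m\<close> is $j - 1$.\<close>

definition phi_q :: "nat \<Rightarrow> nat \<Rightarrow> (nat \<Rightarrow> nat \<Rightarrow> 'f) \<Rightarrow> (nat \<Rightarrow> 'f) \<Rightarrow> nat \<Rightarrow> nat \<Rightarrow> 'f::field" where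
  "phi_q M i q e m l =
     (if l = i then q m (i + 1) * q m i / (phi_e M i q e (M - Suc m) + q m (i + 1))
      else if l = i + 1 then phi_e M i q e (M - Suc m) + q m (i + 1)
      else q m l)"

definition phi_map :: "nat \<Rightarrow> nat \<Rightarrow> nat \<Rightarrow> 'k::field ratmap" where
  "phi_map M N i c =
     (if c \<in> phase_coords M N then
        (case c of
           Q m l \<Rightarrow> phi_q M i (\<lambda>j l. Var (Q j l)) (\<lambda>l. Var (E l)) m l
         | E l \<Rightarrow> (if l = i then phi_e M i (\<lambda>j l. Var (Q j l)) (\<lambda>l. Var (E l)) M else Var c))
      else Var c)"


section \<open>Well-definedness\<close>

lemma Const_simps:
  "Const 0 = 0" "Const 1 = 1" "Const (a + b) = Const a + Const b" "Const (a * b) = Const a * Const b"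
  by (simp_all add: Const_def Zero_fract_def One_fract_def single_add mult_single)

lemma monom_subst_superset:
  assumes "finite A" "Poly_Mapping.keys m \<subseteq> A"
  shows "monom_subst G m = (\<Prod>v\<in>A. G v ^ Poly_Mapping.lookup m v)"
  unfolding monom_subst_def
  by (rule prod.mono_neutral_left) (use assms in \<open>auto simp: in_keys_iff\<close>)

lemma monom_subst_add: "monom_subst G (m + n) = monom_subst G m * monom_subst G n"
proof -
  let ?A = "Poly_Mapping.keys m \<union> Poly_Mapping.keys n"
  have "Poly_Mapping.keys (m + n) \<subseteq> ?A" by (rule keys_add)
  then show ?thesis
    by (simp add: monom_subst_superset[of ?A] lookup_add power_add prod.distrib)
qed

lemma poly_subst_superset:
  assumes "finite A" "Poly_Mapping.keys p \<subseteq> A"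
  shows "poly_subst G p = (\<Sum>m\<in>A. Const (Poly_Mapping.lookup p m) * monom_subst G m)"
  unfolding poly_subst_def
  by (rule sum.mono_neutral_left) (use assms in \<open>auto simp: in_keys_iff Const_simps\<close>)

lemma poly_subst_add: "poly_subst G (p + q) = poly_subst G p + poly_subst G q"
proof -
  let ?A = "Poly_Mapping.keys p \<union> Poly_Mapping.keys q"
  have "Poly_Mapping.keys (p + q) \<subseteq> ?A" by (rule keys_add)
  then show ?thesis
    by (simp add: poly_subst_superset[of ?A] lookup_add Const_simps distrib_right sum.distrib)
qed

lemma poly_subst_0 [simp]: "poly_subst G 0 = 0"
  by (simp add: poly_subst_def)

lemma poly_subst_sum: "poly_subst G (sum f A) = (\<Sum>a\<in>A. poly_subst G (f a))"
  by (induction A rule: infinite_finite_induct) (simp_all add: poly_subst_add)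

lemma poly_subst_single: "poly_subst G (Poly_Mapping.single m a) = Const a * monom_subst G m"
  by (cases "a = 0") (simp_all add: poly_subst_def Const_simps)

lemma poly_subst_1 [simp]: "poly_subst G 1 = 1"
  using poly_subst_single[of G 0 1] by (simp add: Const_simps monom_subst_def)

lemma poly_subst_mult: "poly_subst G (p * q) = poly_subst G p * poly_subst G q"
proof -
  have expand: "r = (\<Sum>m\<in>Poly_Mapping.keys r. Poly_Mapping.single m (Poly_Mapping.lookup r m))"
    for r :: "'a cpoly"
    by (rule poly_mapping_eqI)
       (auto simp: lookup_sum lookup_single when_def in_keys_iff sum.delta)
  have "p * q = (\<Sum>m\<in>Poly_Mapping.keys p. \<Sum>n\<in>Poly_Mapping.keys q.
      Poly_Mapping.single (m + n) (Poly_Mapping.lookup p m * Poly_Mapping.lookup q n))"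
    by (subst expand[of p], subst expand[of q]) (simp add: sum_product mult_single)
  then show ?thesis
    by (simp add: poly_subst_sum poly_subst_single Const_simps monom_subst_add)
       (simp add: poly_subst_def sum_product mult_ac)
qed

lemma subst_rel_unique:
  assumes "subst_rel G r s" "subst_rel G r s'"
  shows "s = s'"
proof -
  obtain p d where 1: "poly_subst G d \<noteq> 0" "r = Fract p d" "s = poly_subst G p / poly_subst G d"
    using assms(1) by (auto simp: subst_rel_def)
  obtain p' d' where 2: "poly_subst G d' \<noteq> 0" "r = Fract p' d'"
    "s' = poly_subst G p' / poly_subst G d'"
    using assms(2) by (auto simp: subst_rel_def)
  have "d \<noteq> 0" "d' \<noteq> 0" using 1 2 by auto
  then have "p * d' = p' * d" using 1 2 by (simp add: eq_fract)
  then have "poly_subst G p * poly_subst G d' = poly_subst G p' * poly_subst G d"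
    by (metis poly_subst_mult)
  then show ?thesis using 1 2 by (simp add: frac_eq_eq)
qed

lemma rat_comp_eqI: "subst_rel G (F c) s \<Longrightarrow> rat_comp F G c = s"
  unfolding rat_comp_def by (blast intro: subst_rel_unique)

lemma subst_rel_Const: "subst_rel G (Const a) (Const a)"
  unfolding subst_rel_def
  by (intro exI[of _ "Poly_Mapping.single 0 a"] exI[of _ 1])
     (simp add: Const_def[of a] poly_subst_single monom_subst_def)

lemma subst_rel_0: "subst_rel G 0 0" and subst_rel_1: "subst_rel G 1 1"
  using subst_rel_Const[of G 0] subst_rel_Const[of G 1] by (simp_all add: Const_simps)

lemma subst_rel_Var: "subst_rel G (Var v) (G v)"
  unfolding subst_rel_def
  by (intro exI[of _ "Poly_Mapping.single (Poly_Mapping.single v 1) 1"] exI[of _ 1])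
     (simp add: Var_def poly_subst_single monom_subst_def Const_simps)

lemma subst_rel_add:
  assumes "subst_rel G r s" "subst_rel G r' s'"
  shows "subst_rel G (r + r') (s + s')"
proof -
  obtain p d where 1: "poly_subst G d \<noteq> 0" "r = Fract p d" "s = poly_subst G p / poly_subst G d"
    using assms(1) by (auto simp: subst_rel_def)
  obtain p' d' where 2: "poly_subst G d' \<noteq> 0" "r' = Fract p' d'"
    "s' = poly_subst G p' / poly_subst G d'"
    using assms(2) by (auto simp: subst_rel_def)
  have "d \<noteq> 0" "d' \<noteq> 0" using 1 2 by auto
  with 1 2 show ?thesis
    unfolding subst_rel_def
    by (intro exI[of _ "p * d' + p' * d"] exI[of _ "d * d'"])
       (simp add: poly_subst_add poly_subst_mult add_frac_eq)
qed

lemma subst_rel_mult: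
  assumes "subst_rel G r s" "subst_rel G r' s'"
  shows "subst_rel G (r * r') (s * s')"
proof -
  obtain p d where 1: "poly_subst G d \<noteq> 0" "r = Fract p d" "s = poly_subst G p / poly_subst G d"
    using assms(1) by (auto simp: subst_rel_def)
  obtain p' d' where 2: "poly_subst G d' \<noteq> 0" "r' = Fract p' d'"
    "s' = poly_subst G p' / poly_subst G d'"
    using assms(2) by (auto simp: subst_rel_def)
  with 1 show ?thesis
    unfolding subst_rel_def
    by (intro exI[of _ "p * p'"] exI[of _ "d * d'"]) (simp add: poly_subst_mult)
qed

lemma subst_rel_uminus:
  assumes "subst_rel G r s"
  shows "subst_rel G (- r) (- s)"
  using subst_rel_mult[OF subst_rel_Const[of G "-1"] assms]
  by (simp add: Const_def single_uminus flip: minus_fract One_fract_def)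

lemma subst_rel_diff:
  "subst_rel G r s \<Longrightarrow> subst_rel G r' s' \<Longrightarrow> subst_rel G (r - r') (s - s')"
  using subst_rel_add[OF _ subst_rel_uminus, of G r s r' s'] by simp

lemma subst_rel_divide:
  assumes "subst_rel G r s" "subst_rel G r' s'" "s' \<noteq> 0"
  shows "subst_rel G (r / r') (s / s')"
proof -
  obtain p d where 1: "poly_subst G d \<noteq> 0" "r = Fract p d" "s = poly_subst G p / poly_subst G d"
    using assms(1) by (auto simp: subst_rel_def)
  obtain p' d' where 2: "poly_subst G d' \<noteq> 0" "r' = Fract p' d'"
    "s' = poly_subst G p' / poly_subst G d'"
    using assms(2) by (auto simp: subst_rel_def)
  have "poly_subst G p' \<noteq> 0" using 2 assms(3) by auto
  with 1 2 show ?thesis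
    unfolding subst_rel_def
    by (intro exI[of _ "p * d'"] exI[of _ "d * p'"]) (simp add: poly_subst_mult)
qed

lemma subst_rel_of_nat: "subst_rel G (of_nat n) (of_nat n)"
  by (induction n) (auto intro: subst_rel_0 subst_rel_add subst_rel_1)

lemma Var_nonzero: "Var v \<noteq> 0"
  by (simp add: Var_def Zero_fract_def eq_fract)
     (metis lookup_single_eq lookup_zero one_neq_zero)

lemma subst_rel_nonzero: "subst_rel G r s \<Longrightarrow> s \<noteq> 0 \<Longrightarrow> r \<noteq> 0"
  using subst_rel_unique[OF _ subst_rel_0] by blast

text \<open>No denominator in the definitions of the two maps vanishes identically, so the convention
  $x / 0 = 0$ plays no role in them.  This is seen by specialising all $e_l$ to $0$.\<close>

definition zero_e :: "'k::field ratmap" where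
  "zero_e c = (case c of Q j l \<Rightarrow> Var (Q j l) | E l \<Rightarrow> 0)"

lemma zero_e_simps [simp]: "zero_e (Q j l) = Var (Q j l)" "zero_e (E l) = 0"
  by (simp_all add: zero_e_def)

lemma subst_rel_zero_e_toda:
  "subst_rel zero_e (toda_q N \<epsilon> (\<lambda>j l. Var (Q j l)) (\<lambda>l. Var (E l)) t l) (Var (Q t l) :: 'k::field ratfun)"
  "subst_rel zero_e (toda_e N \<epsilon> (\<lambda>j l. Var (Q j l)) (\<lambda>l. Var (E l)) t l) (0 :: 'k ratfun)"
proof (induction N \<epsilon> "\<lambda>j l. Var (Q j l) :: 'k ratfun" "\<lambda>l. Var (E l) :: 'k ratfun" t l and
    N \<epsilon> "\<lambda>j l. Var (Q j l) :: 'k ratfun" "\<lambda>l. Var (E l) :: 'k ratfun" t l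
    rule: toda_q_toda_e.induct)
  case (1 N \<epsilon> t l)
  have "subst_rel zero_e (toda_q N \<epsilon> (\<lambda>j l. Var (Q j l)) (\<lambda>l. Var (E l)) t l)
      (zero_e (Q t l) + 0 - 0 :: 'k ratfun)"
    unfolding toda_q.simps[of _ _ _ _ t l]
    by (intro subst_rel_diff subst_rel_add subst_rel_Var 1) (use 1 in \<open>auto intro: subst_rel_0\<close>)
  then show ?case by simp
next
  case (2 N \<epsilon> l)
  then show ?case
    using subst_rel_Var[of zero_e "E l"] by (auto simp: toda_e.simps intro: subst_rel_0)
next
  case (3 N \<epsilon> t l)
  show ?case
  proof (cases "l + 1 < N")
    case True
    let ?p = "if l = 0 then 0 else toda_e N \<epsilon> (\<lambda>j l. Var (Q j l)) (\<lambda>l. Var (E l)) (Suc t) (l - 1)"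
    have "subst_rel zero_e ?p (0 :: 'k ratfun)"
      using 3 True by (auto intro: subst_rel_0)
    then have "subst_rel zero_e (toda_e N \<epsilon> (\<lambda>j l. Var (Q j l)) (\<lambda>l. Var (E l)) (Suc t) l)
        ((zero_e (Q t (l + 1)) + of_nat (\<epsilon> (l + 1)) * 0) /
         (Var (Q t l) + of_nat (\<epsilon> l) * 0) * 0 :: 'k ratfun)"
      unfolding toda_e.simps(2)[of _ _ _ _ t l] if_P[OF True]
      by (intro subst_rel_mult subst_rel_divide subst_rel_add subst_rel_of_nat subst_rel_Var
            3(1,2,4)[OF True])
         (use 3 True in \<open>simp_all add: Var_nonzero\<close>)
    then show ?thesis by simp
  qed (simp add: toda_e.simps subst_rel_0)
qed

lemma toda_denominator_nonzero:
  "toda_q N \<epsilon> (\<lambda>j l. Var (Q j l)) (\<lambda>l. Var (E l)) t l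
     + of_nat (\<epsilon> l) * (if l = 0 then 0
         else toda_e N \<epsilon> (\<lambda>j l. Var (Q j l)) (\<lambda>l. Var (E l)) (Suc t) (l - 1))
   \<noteq> (0 :: 'k::field ratfun)"
proof -
  let ?p = "if l = 0 then 0 else toda_e N \<epsilon> (\<lambda>j l. Var (Q j l)) (\<lambda>l. Var (E l)) (Suc t) (l - 1)"
  have "subst_rel zero_e ?p (0 :: 'k ratfun)"
    by (auto intro: subst_rel_0 subst_rel_zero_e_toda)
  then have "subst_rel zero_e
      (toda_q N \<epsilon> (\<lambda>j l. Var (Q j l)) (\<lambda>l. Var (E l)) t l + of_nat (\<epsilon> l) * ?p)
      (Var (Q t l) + of_nat (\<epsilon> l) * 0 :: 'k ratfun)"
    by (intro subst_rel_add subst_rel_mult subst_rel_of_nat subst_rel_zero_e_toda)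
  then show ?thesis by (rule subst_rel_nonzero) (simp add: Var_nonzero)
qed

lemma subst_rel_zero_e_phi_denominator:
  assumes "subst_rel zero_e x 0"
  shows "subst_rel zero_e (x + Var (Q m l)) (Var (Q m l) :: 'k::field ratfun)"
  using subst_rel_add[OF assms subst_rel_Var[of zero_e "Q m l"]] by simp

lemma subst_rel_zero_e_phi:
  "subst_rel zero_e (phi_e M i (\<lambda>j l. Var (Q j l)) (\<lambda>l. Var (E l)) j) (0 :: 'k::field ratfun)"
proof (induction j)
  case 0
  then show ?case using subst_rel_Var[of zero_e "E i"] by simp
next
  case (Suc j)
  from subst_rel_divide[OF subst_rel_mult[OF Suc subst_rel_Var[of zero_e "Q (M - Suc j) i"]]
      subst_rel_zero_e_phi_denominator[OF Suc] Var_nonzero]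
  show ?case by simp
qed

lemma phi_denominator_nonzero:
  "phi_e M i (\<lambda>j l. Var (Q j l)) (\<lambda>l. Var (E l)) j + Var (Q m (i + 1)) \<noteq> (0 :: 'k::field ratfun)"
  by (rule subst_rel_nonzero[OF subst_rel_zero_e_phi_denominator[OF subst_rel_zero_e_phi] Var_nonzero])

end

theory Submission
  imports Defs
begin

text \<open>Up to commutation, \<open>L\<^sub>1 L\<^sub>2\<close> is a product of elementary matrices
  \<open>X\<^sub>l = I + e\<^sub>l E\<^bsub>l+2,l+1\<^esub>\<close>, in which \<open>X\<^sub>i\<close> is the last factor among its neighbours for
  \<open>\<epsilon>\<close> and the first one for \<open>\<epsilon>'\<close>.  The map \<open>\<phi>\<^sub>i\<close> carries \<open>X\<^sub>i\<close> through
  \<open>R\<^bsup>(M-1)\<^esup> \<dots> R\<^bsup>(0)\<^esup>\<close> to the other end of the Lax matrix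
  \<open>L\<^sub>1 L\<^sub>2 R\<^bsup>(M-1)\<^esup> \<dots> R\<^bsup>(0)\<^esup>\<close>.  The key relation is that carrying
  \<open>X\<^sub>i\<close> at time \<open>t + 1\<close> through \<open>R\<^bsup>(t+M)\<^esup>\<close> gives back \<open>X\<^sub>i\<close> at time \<open>t\<close>; hence applying
  \<open>\<phi>\<^sub>i\<close> after \<open>\<T>\<^sub>\<epsilon>\<close> runs through \<open>e\<^sub>i\<^bsup>(M)\<^esup>, \<dots>, e\<^sub>i\<^bsup>(0)\<^esup>\<close> backwards in time, while along the
  transformed orbit \<open>e\<^sub>i\<close> runs through \<open>e\<^sub>i\<^bsup>(0,M)\<^esup>, \<dots>, e\<^sub>i\<^bsup>(0,0)\<^esup>\<close>.  All denominators
  of the composed maps turn out to be denominators of the original ones, or some \<open>q\<^sub>i\<^bsup>(t)\<^esup>\<close>.\<close>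

section \<open>Evaluation of the two maps at a point\<close>

abbreviation toda_prev ::
  "nat \<Rightarrow> (nat \<Rightarrow> nat) \<Rightarrow> (nat \<Rightarrow> nat \<Rightarrow> 'f) \<Rightarrow> (nat \<Rightarrow> 'f) \<Rightarrow> nat \<Rightarrow> nat \<Rightarrow> 'f::field" where
  "toda_prev N \<epsilon> q e t l \<equiv> (if l = 0 then 0 else toda_e N \<epsilon> q e (Suc t) (l - 1))"

abbreviation toda_den ::
  "nat \<Rightarrow> (nat \<Rightarrow> nat) \<Rightarrow> (nat \<Rightarrow> nat \<Rightarrow> 'f) \<Rightarrow> (nat \<Rightarrow> 'f) \<Rightarrow> nat \<Rightarrow> nat \<Rightarrow> 'f::field" where
  "toda_den N \<epsilon> q e t l \<equiv> toda_q N \<epsilon> q e t l + of_nat (\<epsilon> l) * toda_prev N \<epsilon> q e t l"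

lemma toda_e_boundary: "\<not> l + 1 < N \<Longrightarrow> toda_e N \<epsilon> q e t l = 0"
  by (cases t) (simp_all add: toda_e.simps)

lemma subst_rel_toda_q:
  assumes "subst_rel G (toda_e N \<epsilon> (\<lambda>j l. Var (Q j l)) (\<lambda>l. Var (E l)) t l)
      (toda_e N \<epsilon> (\<lambda>j l. G (Q j l)) (\<lambda>l. G (E l)) t l)"
    and "subst_rel G (toda_prev N \<epsilon> (\<lambda>j l. Var (Q j l)) (\<lambda>l. Var (E l)) t l)
      (toda_prev N \<epsilon> (\<lambda>j l. G (Q j l)) (\<lambda>l. G (E l)) t l)"
  shows "subst_rel G (toda_q N \<epsilon> (\<lambda>j l. Var (Q j l)) (\<lambda>l. Var (E l)) t l)
      (toda_q N \<epsilon> (\<lambda>j l. G (Q j l)) (\<lambda>l. G (E l)) t l :: 'k::field ratfun)"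
  unfolding toda_q.simps[of _ _ _ _ t l]
  by (intro subst_rel_diff subst_rel_add subst_rel_Var assms)

text \<open>The double induction follows the order of computation: time \<open>t\<close> at all
  sites, then time \<open>t + 1\<close> from left to right. Divisions occur only for
  \<open>l + 1 < N\<close>, so only those denominators must survive at \<open>G\<close>.\<close>

lemma subst_rel_toda_e:
  assumes "\<And>t l. t < M \<Longrightarrow> l + 1 < N \<Longrightarrow>
      toda_den N \<epsilon> (\<lambda>j l. G (Q j l)) (\<lambda>l. G (E l)) t l \<noteq> 0"
    and "t \<le> M"
  shows "subst_rel G (toda_e N \<epsilon> (\<lambda>j l. Var (Q j l)) (\<lambda>l. Var (E l)) t l)
      (toda_e N \<epsilon> (\<lambda>j l. G (Q j l)) (\<lambda>l. G (E l)) t l :: 'k::field ratfun)"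
  using \<open>t \<le> M\<close>
proof (induction t arbitrary: l)
  case 0
  show ?case by (auto simp: toda_e.simps intro: subst_rel_0 subst_rel_Var)
next
  case (Suc t l)
  have e: "subst_rel G (toda_e N \<epsilon> (\<lambda>j l. Var (Q j l)) (\<lambda>l. Var (E l)) t k)
      (toda_e N \<epsilon> (\<lambda>j l. G (Q j l)) (\<lambda>l. G (E l)) t k)" for k
    using Suc by simp
  show ?case
  proof (induction l)
    case 0
    show ?case
    proof (cases "1 < N")
      case True
      have p: "subst_rel G (toda_prev N \<epsilon> (\<lambda>j l. Var (Q j l)) (\<lambda>l. Var (E l)) t 0)
          (toda_prev N \<epsilon> (\<lambda>j l. G (Q j l)) (\<lambda>l. G (E l)) t 0)"
        by (simp add: subst_rel_0)
      have N: "0 + 1 < N" using True by simp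
      show ?thesis
        unfolding toda_e.simps(2)[of _ _ _ _ t 0] if_P[OF N]
        by (intro subst_rel_mult subst_rel_divide subst_rel_add subst_rel_of_nat subst_rel_Var
            subst_rel_toda_q e p assms(1) N) (use Suc.prems in simp)
    qed (simp add: toda_e_boundary subst_rel_0)
  next
    case (Suc l)
    show ?case
    proof (cases "Suc l + 1 < N")
      case True
      have p: "subst_rel G (toda_prev N \<epsilon> (\<lambda>j l. Var (Q j l)) (\<lambda>l. Var (E l)) t (Suc l))
          (toda_prev N \<epsilon> (\<lambda>j l. G (Q j l)) (\<lambda>l. G (E l)) t (Suc l))"
        using Suc by simp
      show ?thesis
        unfolding toda_e.simps(2)[of _ _ _ _ t "Suc l"] if_P[OF True]
        by (intro subst_rel_mult subst_rel_divide subst_rel_add subst_rel_of_nat subst_rel_Var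
            subst_rel_toda_q e p assms(1) True) (use \<open>Suc t \<le> M\<close> in simp)
    qed (simp add: toda_e_boundary subst_rel_0)
  qed
qed

lemma subst_rel_phi_e:
  assumes "\<And>j. j < M \<Longrightarrow>
      phi_e M i (\<lambda>j l. G (Q j l)) (\<lambda>l. G (E l)) j + G (Q (M - Suc j) (i + 1)) \<noteq> 0"
    and "j \<le> M"
  shows "subst_rel G (phi_e M i (\<lambda>j l. Var (Q j l)) (\<lambda>l. Var (E l)) j)
      (phi_e M i (\<lambda>j l. G (Q j l)) (\<lambda>l. G (E l)) j :: 'k::field ratfun)"
  using \<open>j \<le> M\<close>
proof (induction j)
  case 0
  show ?case by (simp add: subst_rel_Var)
next
  case (Suc j)
  then show ?case
    unfolding phi_e.simps
    by (intro subst_rel_divide subst_rel_mult subst_rel_add subst_rel_Var Suc.IH assms(1)) simp_all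
qed

lemma subst_rel_phi_q:
  assumes den: "\<And>j. j < M \<Longrightarrow>
      phi_e M i (\<lambda>j l. G (Q j l)) (\<lambda>l. G (E l)) j + G (Q (M - Suc j) (i + 1)) \<noteq> 0"
    and "m < M"
  shows "subst_rel G (phi_q M i (\<lambda>j l. Var (Q j l)) (\<lambda>l. Var (E l)) m l)
      (phi_q M i (\<lambda>j l. G (Q j l)) (\<lambda>l. G (E l)) m l :: 'k::field ratfun)"
proof -
  have e: "subst_rel G (phi_e M i (\<lambda>j l. Var (Q j l)) (\<lambda>l. Var (E l)) (M - Suc m))
      (phi_e M i (\<lambda>j l. G (Q j l)) (\<lambda>l. G (E l)) (M - Suc m))"
    by (intro subst_rel_phi_e den) simp_all
  have "phi_e M i (\<lambda>j l. G (Q j l)) (\<lambda>l. G (E l)) (M - Suc m) + G (Q m (i + 1)) \<noteq> 0"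
    using den[of "M - Suc m"] \<open>m < M\<close> by simp
  then show ?thesis
    unfolding phi_q_def
    by (auto intro!: subst_rel_divide subst_rel_mult subst_rel_add subst_rel_Var e
        simp del: Suc_eq_plus1)
qed


section \<open>The commutation relation over a field\<close>

text \<open>Separates the field identities from substitution. The nonvanishing conditions can range
  over all indices because the intended point consists of indeterminates, one for every
  index.\<close>

locale toda_exchange =
  fixes M N i :: nat and \<epsilon> \<epsilon>' :: "nat \<Rightarrow> nat"
    and q :: "nat \<Rightarrow> nat \<Rightarrow> 'f::field" and e :: "nat \<Rightarrow> 'f"
  assumes i_less: "i + 1 < N"
    and eps: "\<epsilon> i = 0" "\<epsilon> (i + 1) = 1"
    and eps': "\<epsilon>' i = 1" "\<epsilon>' (i + 1) = 0"
    and eps'_other: "l < N \<Longrightarrow> l \<noteq> i \<Longrightarrow> l \<noteq> i + 1 \<Longrightarrow> \<epsilon>' l = \<epsilon> l"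
    and q_nonzero: "q t i \<noteq> 0"
    and toda_den_nonzero: "toda_den N \<epsilon> q e t l \<noteq> 0"
    and phi_den_nonzero: "phi_e M i q e j + q m (i + 1) \<noteq> 0"
begin

section \<open>One time step of the original orbit at sites i and i + 1\<close>

abbreviation "tq \<equiv> toda_q N \<epsilon> q e"
abbreviation "te \<equiv> toda_e N \<epsilon> q e"

lemma tq_add_te: "te (Suc t) i + tq t (i + 1) = q t (i + 1) + te t (i + 1)"
  by (simp add: toda_q.simps)

text \<open>As \<open>\<epsilon> (i + 1) = 1\<close>, this sum is the Toda denominator at site
  \<open>i + 1\<close>; it is also the denominator of \<phi> at the evolved point.\<close>

lemma tq_add_te_nonzero: "te (Suc t) i + tq t (i + 1) \<noteq> 0"
  using toda_den_nonzero[of t "i + 1"] eps by (simp add: add.commute)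

text \<open>As \<open>\<epsilon> i = 0\<close>, the recursion for \<open>te (Suc t) i\<close>
  divides by \<open>tq t i\<close> alone, and its numerator is the sum in
  \<open>tq_add_te\<close>.\<close>

lemma te_Suc_mult_tq: "te (Suc t) i * tq t i = te t i * (te (Suc t) i + tq t (i + 1))"
proof -
  have "tq t i \<noteq> 0" using toda_den_nonzero[of t i] eps by simp
  then show ?thesis
    unfolding tq_add_te by (subst toda_e.simps) (simp add: i_less[simplified] eps[simplified])
qed

text \<open>The left side is one step of the \<open>phi_e\<close> recursion at the evolved point, so
  each such step undoes one time step.\<close>

lemma te_backwards: "te (Suc t) i * tq t i / (te (Suc t) i + tq t (i + 1)) = te t i"
  by (simp only: te_Suc_mult_tq) (simp add: tq_add_te_nonzero[simplified])

lemma tq_exchange: "tq t (i + 1) * tq t i / (te (Suc t) i + tq t (i + 1)) = tq t i - te t i"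
proof -
  have "tq t (i + 1) * tq t i = (tq t i - te t i) * (te (Suc t) i + tq t (i + 1))"
    using te_Suc_mult_tq[of t] by (simp add: algebra_simps)
  then show ?thesis using tq_add_te_nonzero[of t] by simp
qed

text \<open>Both summands have the same denominator, and their numerators add up to
  \<open>q t i\<close> times it.\<close>

lemma phi_q_add_phi_e:
  assumes "t < M"
  shows "phi_q M i q e t i + phi_e M i q e (M - t) = q t i"
proof -
  have "M - t = Suc (M - Suc t)" "M - Suc (M - Suc t) = t" using assms by auto
  then show ?thesis
    using phi_den_nonzero[of "M - Suc t" t]
    by (simp add: phi_q_def add_divide_distrib[symmetric] divide_eq_eq algebra_simps)
qed

section \<open>The exchange map after the time evolution\<close>

context
  fixes q' :: "nat \<Rightarrow> nat \<Rightarrow> 'f" and e' :: "nat \<Rightarrow> 'f"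
  assumes q': "m < M \<Longrightarrow> l < N \<Longrightarrow> q' m l = tq m l"
    and e': "l + 1 < N \<Longrightarrow> e' l = te M l"
begin

lemma phi_e_toda: "j \<le> M \<Longrightarrow> phi_e M i q' e' j = te (M - j) i"
proof (induction j)
  case 0
  show ?case using e' i_less by simp
next
  case (Suc j)
  then have j: "phi_e M i q' e' j = te (Suc (M - Suc j)) i" by (simp add: Suc_diff_Suc)
  show ?case
    using q'[of "M - Suc j" i] q'[of "M - Suc j" "i + 1"] i_less Suc.prems
      te_backwards[of "M - Suc j"]
    by (simp add: j)
qed

lemma phi_den_toda:
  assumes "j < M"
  shows "phi_e M i q' e' j + q' (M - Suc j) (i + 1) \<noteq> 0"
  using phi_e_toda[of j] q'[of "M - Suc j" "i + 1"] i_less assms tq_add_te_nonzero[of "M - Suc j"]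
  by (simp add: Suc_diff_Suc)

lemma phi_q_toda:
  assumes "m < M" "l < N"
  shows "phi_q M i q' e' m l =
    (if l = i then tq m i - te m i
     else if l = i + 1 then q m (i + 1) + te m (i + 1) else tq m l)"
proof -
  have "phi_e M i q' e' (M - Suc m) = te (Suc m) i"
    using phi_e_toda[of "M - Suc m"] assms by simp
  then show ?thesis
    using q'[of m i] q'[of m "i + 1"] q'[of m l] i_less assms tq_exchange[of m] tq_add_te[of m]
    by (simp add: phi_q_def)
qed

end

section \<open>The time evolution for \<epsilon>' after the exchange map\<close>

context
  fixes q' :: "nat \<Rightarrow> nat \<Rightarrow> 'f" and e' :: "nat \<Rightarrow> 'f"
  assumes q': "m < M \<Longrightarrow> l < N \<Longrightarrow> q' m l = phi_q M i q e m l"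
    and e': "l + 1 < N \<Longrightarrow> e' l = (if l = i then phi_e M i q e M else e l)"
begin

abbreviation "tq' \<equiv> toda_q N \<epsilon>' q' e'"
abbreviation "te' \<equiv> toda_e N \<epsilon>' q' e'"

text \<open>The induction invariant: at site \<open>i\<close> the new orbit passes through the
  intermediate values of \<phi> in reverse order, and elsewhere it keeps the old values.\<close>

definition e_claim :: "nat \<Rightarrow> nat \<Rightarrow> bool" where
  "e_claim t l \<longleftrightarrow> te' t l = (if l = i then phi_e M i q e (M - t) else te t l)"

lemma tq'_step:
  assumes "t < M" "l < N" "e_claim t l" "l \<noteq> 0 \<Longrightarrow> e_claim (Suc t) (l - 1)"
  shows "tq' t l =
    (if l = i then tq t i - te t i
     else if l = i + 1 then q t (i + 1) + te t (i + 1) else tq t l)"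
proof -
  have tq': "tq' t l = phi_q M i q e t l + te' t l - toda_prev N \<epsilon>' q' e' t l"
    using q' assms by (simp add: toda_q.simps)
  consider "l = i" | "l = i + 1" | "l \<noteq> i" "l \<noteq> i + 1" by blast
  then show ?thesis
  proof cases
    case 1
    have "toda_prev N \<epsilon>' q' e' t l = toda_prev N \<epsilon> q e t l"
      using assms 1 by (auto simp: e_claim_def)
    moreover have "te' t l = phi_e M i q e (M - t)" using assms 1 by (simp add: e_claim_def)
    ultimately have "tq' t l = q t i - toda_prev N \<epsilon> q e t l"
      using tq' phi_q_add_phi_e[OF \<open>t < M\<close>] 1 by simp
    then show ?thesis using 1 by (simp add: toda_q.simps)
  next
    \<comment> \<open>The subtracted predecessor is \<open>phi_e M i q e (M - Suc t)\<close>, which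
      cancels the same term in \<open>phi_q\<close>.\<close>
    case 2
    then show ?thesis using tq' assms by (simp add: e_claim_def phi_q_def)
  next
    case 3
    then have "toda_prev N \<epsilon>' q' e' t l = toda_prev N \<epsilon> q e t l"
      using assms by (auto simp: e_claim_def)
    then show ?thesis using tq' assms 3 by (simp add: e_claim_def phi_q_def toda_q.simps)
  qed
qed

text \<open>At site \<open>i\<close>, \<open>\<epsilon>' i = 1\<close> adds back the predecessor
  that \<open>tq' t i\<close> subtracts. At site \<open>i + 1\<close>, the old denominator already
  equals \<open>q t (i + 1) + te t (i + 1)\<close> by \<open>tq_add_te\<close>.\<close>

lemma toda_den'_step:
  assumes "t < M" "l < N" "e_claim t l" "l \<noteq> 0 \<Longrightarrow> e_claim (Suc t) (l - 1)"
  shows "toda_den N \<epsilon>' q' e' t l = (if l = i then q t i else toda_den N \<epsilon> q e t l)"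
proof -
  consider "l = i" | "l = i + 1" | "l \<noteq> i" "l \<noteq> i + 1" by blast
  then show ?thesis
  proof cases
    case 1
    have "toda_prev N \<epsilon>' q' e' t l = toda_prev N \<epsilon> q e t l"
      using assms 1 by (auto simp: e_claim_def)
    then show ?thesis using tq'_step[OF assms] 1 eps' by (simp add: toda_q.simps)
  next
    case 2
    then show ?thesis using tq'_step[OF assms] eps eps' tq_add_te[of t] by (simp add: add.commute)
  next
    case 3
    then have "toda_prev N \<epsilon>' q' e' t l = toda_prev N \<epsilon> q e t l"
      using assms by (auto simp: e_claim_def)
    then show ?thesis using tq'_step[OF assms] 3 eps'_other[of l] assms by simp
  qed
qed

lemma te'_step:
  assumes "t < M" "l + 1 < N" "e_claim t l" "e_claim t (l + 1)"
    "l \<noteq> 0 \<Longrightarrow> e_claim (Suc t) (l - 1)"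
  shows "e_claim (Suc t) l"
proof -
  have den: "toda_den N \<epsilon>' q' e' t l = (if l = i then q t i else toda_den N \<epsilon> q e t l)"
    using toda_den'_step assms by simp
  have te': "te' (Suc t) l = (phi_q M i q e t (l + 1) + of_nat (\<epsilon>' (l + 1)) * te' t (l + 1)) /
      toda_den N \<epsilon>' q' e' t l * te' t l"
    using q' assms by (subst toda_e.simps) simp
  have te: "te (Suc t) l = (q t (l + 1) + of_nat (\<epsilon> (l + 1)) * te t (l + 1)) /
      toda_den N \<epsilon> q e t l * te t l"
    using assms by (subst toda_e.simps) simp
  consider "l = i" | "l + 1 = i" | "l \<noteq> i" "l + 1 \<noteq> i" by blast
  then show ?thesis
  proof cases
    case 1
    have M: "M - t = Suc (M - Suc t)" "M - Suc (M - Suc t) = t" using assms by auto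
    have "te' (Suc t) l = (phi_e M i q e (M - Suc t) + q t (i + 1)) / q t i * phi_e M i q e (M - t)"
      unfolding te' den using 1 eps' assms by (simp add: e_claim_def phi_q_def)
    also have "\<dots> = phi_e M i q e (M - Suc t)"
      \<comment> \<open>Unfolding the last step of \<open>phi_e M i q e (M - t)\<close> shows that
        the Toda factor is exactly its inverse.\<close>
      using phi_den_nonzero[of "M - Suc t" t] q_nonzero[of t] by (simp add: M)
    finally show ?thesis using 1 by (simp add: e_claim_def)
  next
    case 2
    \<comment> \<open>The term switched on by \<open>\<epsilon>' i = 1\<close> restores
      \<open>q t i\<close>, which is the whole old numerator because
      \<open>\<epsilon> i = 0\<close>.\<close>
    have "phi_q M i q e t (l + 1) + of_nat (\<epsilon>' (l + 1)) * te' t (l + 1) = q t i"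
      using phi_q_add_phi_e[OF \<open>t < M\<close>] 2 eps' assms by (simp add: e_claim_def)
    then show ?thesis
      unfolding e_claim_def te' te den using 2 eps assms by (auto simp: e_claim_def)
  next
    case 3
    have "of_nat (\<epsilon>' (l + 1)) * te' t (l + 1) = of_nat (\<epsilon> (l + 1)) * te t (l + 1)"
      using eps'_other[of "l + 1"] assms 3 by (simp add: e_claim_def)
    then show ?thesis
      unfolding e_claim_def te' te den using 3 assms by (simp add: e_claim_def phi_q_def)
  qed
qed

lemma te'_eq: "t \<le> M \<Longrightarrow> e_claim t l"
proof (induction t arbitrary: l)
  case 0
  show ?case using e' i_less by (simp add: e_claim_def toda_e.simps)
next
  case (Suc t l)
  show ?case
  proof (induction l)
    case 0
    show ?case
      by (rule te'_step) (use Suc i_less in simp_all)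
  next
    case (Suc l)
    show ?case
    proof (cases "Suc l + 1 < N")
      case True
      show ?thesis
        by (rule te'_step) (use True Suc \<open>Suc t \<le> M\<close> \<open>\<And>l. t \<le> M \<Longrightarrow> e_claim t l\<close> in simp_all)
    next
      case False
      then show ?thesis using i_less by (auto simp: e_claim_def toda_e_boundary)
    qed
  qed
qed

lemma toda_e_phi: "l + 1 < N \<Longrightarrow> te' M l = (if l = i then e i else te M l)"
  using te'_eq[of M l] by (simp add: e_claim_def)

lemma toda_q_phi:
  assumes "t < M" "l < N"
  shows "tq' t l =
    (if l = i then tq t i - te t i
     else if l = i + 1 then q t (i + 1) + te t (i + 1) else tq t l)"
  using assms by (intro tq'_step te'_eq) simp_all

lemma toda_den_phi_nonzero:
  assumes "t < M" "l < N"
  shows "toda_den N \<epsilon>' q' e' t l \<noteq> 0"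
proof -
  have "toda_den N \<epsilon>' q' e' t l = (if l = i then q t i else toda_den N \<epsilon> q e t l)"
    using assms by (intro toda_den'_step te'_eq) simp_all
  then show ?thesis using q_nonzero toda_den_nonzero by (cases "l = i") simp_all
qed

end

end


section \<open>The rational maps\<close>

theorem proposition3p1:
  fixes M N i :: nat and \<epsilon> \<epsilon>' :: "nat \<Rightarrow> nat"
  assumes "M \<ge> 1" and "N \<ge> 2" and "i \<le> N - 2"
    and "\<forall>j<N. \<epsilon> j \<in> {0, 1}"
    and "\<epsilon> i = 0" and "\<epsilon> (i + 1) = 1"
    and "\<epsilon>' i = 1" and "\<epsilon>' (i + 1) = 0"
    and "\<forall>j<N. j \<noteq> i \<and> j \<noteq> i + 1 \<longrightarrow> \<epsilon>' j = \<epsilon> j"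
  shows "rat_composable (phase_coords M N) (phi_map M N i :: 'k::field ratmap) (toda_map M N \<epsilon>) \<and>
         rat_composable (phase_coords M N) (toda_map M N \<epsilon>') (phi_map M N i :: 'k ratmap) \<and>
         (\<forall>c\<in>phase_coords M N.
            rat_comp (phi_map M N i) (toda_map M N \<epsilon>) c =
            (rat_comp (toda_map M N \<epsilon>') (phi_map M N i) c :: 'k ratfun))"
proof -
  define q :: "nat \<Rightarrow> nat \<Rightarrow> 'k ratfun" where "q = (\<lambda>j l. Var (Q j l))"
  define e :: "nat \<Rightarrow> 'k ratfun" where "e = (\<lambda>l. Var (E l))"
  interpret toda_exchange M N i \<epsilon> \<epsilon>' q e
  proof
    show "i + 1 < N" using assms(2,3) by linarith
  qed (use assms in \<open>simp_all only: q_def e_def toda_denominator_nonzero phi_denominator_nonzero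
      Var_nonzero not_False_eq_True simp_thms\<close>)
  let ?T = "toda_map M N \<epsilon> :: 'k ratmap" and ?P = "phi_map M N i :: 'k ratmap"
  have T: "?T (Q m l) = tq m l" if "m < M" "l < N" for m l
    using that by (simp add: toda_map_def phase_coords_def q_def e_def)
  have TE: "?T (E l) = te M l" if "l + 1 < N" for l
    using that by (simp add: toda_map_def phase_coords_def q_def e_def)
  have P: "?P (Q m l) = phi_q M i q e m l" if "m < M" "l < N" for m l
    using that by (simp add: phi_map_def phase_coords_def q_def e_def)
  have PE: "?P (E l) = (if l = i then phi_e M i q e M else e l)" if "l + 1 < N" for l
    using that by (simp add: phi_map_def phase_coords_def q_def e_def)
  \<comment> \<open>The common value of both compositions, as given by \<open>phi_q_toda\<close>,
    \<open>toda_q_phi\<close> and their analogues for e.\<close>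
  define s where "s c = (case c of
      Q m l \<Rightarrow> if l = i then tq m i - te m i
        else if l = i + 1 then q m (i + 1) + te m (i + 1) else tq m l
    | E l \<Rightarrow> if l = i then e i else te M l)" for c
  have \<phi>T: "subst_rel ?T (?P c) (s c)" if "c \<in> phase_coords M N" for c
  proof (cases c)
    case (Q m l)
    then have ml: "m < M" "l < N" using that by (auto simp: phase_coords_def)
    have "subst_rel ?T (?P c) (phi_q M i (\<lambda>j l. ?T (Q j l)) (\<lambda>l. ?T (E l)) m l)"
      unfolding Q P[OF ml] q_def e_def
      by (intro subst_rel_phi_q phi_den_toda T TE ml) simp_all
    also have "phi_q M i (\<lambda>j l. ?T (Q j l)) (\<lambda>l. ?T (E l)) m l = s c"
      unfolding Q s_def coord.case by (intro phi_q_toda T TE ml) simp_all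
    finally show ?thesis .
  next
    case (E l)
    then have l: "l + 1 < N" using that by (auto simp: phase_coords_def)
    show ?thesis
    proof (cases "l = i")
      case True
      have "subst_rel ?T (?P c) (phi_e M i (\<lambda>j l. ?T (Q j l)) (\<lambda>l. ?T (E l)) M)"
        unfolding E PE[OF l] if_P[OF True] q_def e_def
        by (intro subst_rel_phi_e phi_den_toda T TE) simp_all
      also have "phi_e M i (\<lambda>j l. ?T (Q j l)) (\<lambda>l. ?T (E l)) M = te (M - M) i"
        by (intro phi_e_toda T TE) simp_all
      \<comment> \<open>The backward run ends at time 0, where \<open>te 0 i\<close> is the initial
        value \<open>e i\<close>.\<close>
      also have "\<dots> = s c" using E True l by (simp add: s_def toda_e.simps)
      finally show ?thesis .
    next
      case False
      then show ?thesis
        using subst_rel_Var[of ?T "E l"] PE[OF l] TE[OF l] by (simp add: E s_def e_def)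
    qed
  qed
  have T\<phi>: "subst_rel ?P (toda_map M N \<epsilon>' c) (s c)" if "c \<in> phase_coords M N" for c
  proof -
    have den: "toda_den N \<epsilon>' (\<lambda>j l. ?P (Q j l)) (\<lambda>l. ?P (E l)) t l \<noteq> 0"
      if "t < M" "l + 1 < N" for t l
      using that by (intro toda_den_phi_nonzero P PE) simp_all
    have te': "subst_rel ?P (toda_e N \<epsilon>' (\<lambda>j l. Var (Q j l)) (\<lambda>l. Var (E l)) t l)
        (toda_e N \<epsilon>' (\<lambda>j l. ?P (Q j l)) (\<lambda>l. ?P (E l)) t l)" if "t \<le> M" for t l
      using den that by (rule subst_rel_toda_e)
    show ?thesis
    proof (cases c)
      case (Q m l)
      then have ml: "m < M" "l < N" using that by (auto simp: phase_coords_def)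
      have "subst_rel ?P (toda_q N \<epsilon>' (\<lambda>j l. Var (Q j l)) (\<lambda>l. Var (E l)) m l)
          (toda_q N \<epsilon>' (\<lambda>j l. ?P (Q j l)) (\<lambda>l. ?P (E l)) m l)"
        using ml te' by (intro subst_rel_toda_q) (auto intro: subst_rel_0)
      also have "toda_q N \<epsilon>' (\<lambda>j l. ?P (Q j l)) (\<lambda>l. ?P (E l)) m l = s c"
        unfolding Q s_def coord.case by (intro toda_q_phi P PE ml) simp_all
      finally show ?thesis using that by (simp add: Q toda_map_def)
    next
      case (E l)
      then have l: "l + 1 < N" using that by (auto simp: phase_coords_def)
      have "toda_e N \<epsilon>' (\<lambda>j l. ?P (Q j l)) (\<lambda>l. ?P (E l)) M l = s c"
        unfolding E s_def coord.case by (intro toda_e_phi P PE l) simp_all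
      then show ?thesis using te'[of M l] that by (simp add: E toda_map_def)
    qed
  qed
  have "rat_comp ?P ?T c = rat_comp (toda_map M N \<epsilon>') ?P c" if "c \<in> phase_coords M N" for c
    using rat_comp_eqI[of ?T ?P, OF \<phi>T[OF that]] rat_comp_eqI[of ?P "toda_map M N \<epsilon>'", OF T\<phi>[OF that]] by simp
  then show ?thesis using \<phi>T T\<phi> unfolding rat_composable_def by blast
qed

end
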